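(* Let $X$ and $Y$ be sets equipped with large scale structures, let $n\ge 1$ be an integer, and let $f:X\to Y$ be coarse and large scale $n$-to-$1$. (a) If $X$ is of bounded geometry, then $Y$ is of bounded geometry. (b) Conversely, if $X$ and $Y$ are both metric spaces (with their metric large scale structures) and $Y$ is of bounded geometry, then there exists a subspace $Z\subset X$ of bounded geometry for which the inclusion induces a coarse equivalence from $Z$ to $X$.
   Context: For a set $X$, a subset $A\subset X$ and a family $\mathcal{V}$ of subsets of $X$, the star is $st(A,\mathcal{V})=\bigcup\{V\in\mathcal{V}: V\cap A\neq\emptyset\}$; for two families, $st(\mathcal{U},\mathcal{V})=\{st(U,\mathcal{V}):U\in\mathcal{U}\}$. A family $\mathcal{V}$ refines a family $\mathcal{U}$ if each element of $\mathcal{V}$ is contained in some element of $\mathcal{U}$. A large scale structure on a set $X$ is a nonempty set $\mathcal{LSS}_X$ of covers of $X$ that is closed under refinements (every cover of $X$ refining a member is a member) and such that $\mathcal{B}_1,\mathcal{B}_2\in\mathcal{LSS}_X$ implies $st(\mathcal{B}_1,\mathcal{B}_2)\in\mathcal{LSS}_X$. The members of $\mathcal{LSS}_X$ are called uniformly bounded covers of $X$. The metric large scale structure of a metric space consists of all covers by sets whose diameters are bounded by a common finite constant. A function $f:X\to Y$ is coarse if for every $\mathcal{B}_X\in\mathcal{LSS}_X$ there is $\mathcal{B}_Y\in\mathcal{LSS}_Y$ such that $f(\mathcal{B}_X)=\{f(B):B\in\mathcal{B}_X\}$ refines $\mathcal{B}_Y$. It is large scale (or coarsely) $n$-to-$1$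 if for every uniformly bounded cover $\mathcal{U}_Y$ of $Y$ there is a uniformly bounded cover $\mathcal{U}_X$ of $X$ such that for every $B\in\mathcal{U}_Y$ there exist (not necessarily distinct) $B_1,\ldots,B_n\in\mathcal{U}_X$ with $f^{-1}(B)\subset\bigcup_{i=1}^nB_i$. A set with a large scale structure is of bounded geometry if for every uniformly bounded cover $\mathcal{U}$ there is a finite number $m(\mathcal{U})>0$ such that every subset contained in an element of $\mathcal{U}$ has at most $m(\mathcal{U})$ points. A subspace $Z$ of a metric space $X$ carries the restricted metric; the inclusion $Z\to X$ is a coarse equivalence if and only if $Z$ is an $R$-net in $X$ for some $R>0$, i.e. every point of $X$ is within distance $R$ of some point of $Z$.
   Formalization: In part (a), f is additionally assumed surjective; without this the claim fails, e.g. for the inclusion of one point into the natural numbers with all covers uniformly bounded. Part (b) is as stated. *)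

theory Defs
  imports "HOL-Analysis.Analysis"
begin

text \<open>
  A large scale structure lives on a carrier set; a family of subsets is a set of sets, and a large
  scale structure is a set of such families.
\<close>

definition covers :: "'a set set \<Rightarrow> 'a set \<Rightarrow> bool"
  where "covers \<U> X \<longleftrightarrow> \<Union>\<U> = X"

definition refines :: "'a set set \<Rightarrow> 'a set set \<Rightarrow> bool"
  where "refines \<V> \<U> \<longleftrightarrow> (\<forall>V\<in>\<V>. \<exists>U\<in>\<U>. V \<subseteq> U)"

definition st :: "'a set \<Rightarrow> 'a set set \<Rightarrow> 'a set"
  where "st A \<V> = \<Union>{V \<in> \<V>. V \<inter> A \<noteq> {}}"

definition st_family :: "'a set set \<Rightarrow> 'a set set \<Rightarrow> 'a set set"
  where "st_family \<U> \<V> = {st U \<V> | U. U \<in> \<U>}"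

definition large_scale_structure :: "'a set \<Rightarrow> 'a set set set \<Rightarrow> bool"
  where "large_scale_structure X L \<longleftrightarrow>
    L \<noteq> {} \<and> (\<forall>\<B>\<in>L. covers \<B> X) \<and>
    (\<forall>\<B>\<in>L. \<forall>\<V>. covers \<V> X \<and> refines \<V> \<B> \<longrightarrow> \<V> \<in> L) \<and>
    (\<forall>\<B>1\<in>L. \<forall>\<B>2\<in>L. st_family \<B>1 \<B>2 \<in> L)"

text \<open>
  The bound on diameters is written pointwise: the library's \<open>diameter\<close> belongs to the type class
  and is 0 on unbounded sets.
\<close>

definition metric_lss :: "'a set \<Rightarrow> ('a \<Rightarrow> 'a \<Rightarrow> real) \<Rightarrow> 'a set set set"
  where "metric_lss X d =
    {\<U>. covers \<U> X \<and> (\<exists>r. \<forall>U\<in>\<U>. \<forall>x\<in>U. \<forall>y\<in>U. d x y \<le> r)}"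

definition coarse :: "'a set set set \<Rightarrow> 'b set set set \<Rightarrow> ('a \<Rightarrow> 'b) \<Rightarrow> bool"
  where "coarse LX LY f \<longleftrightarrow> (\<forall>\<B>X\<in>LX. \<exists>\<B>Y\<in>LY. refines {f ` B | B. B \<in> \<B>X} \<B>Y)"

definition large_scale_n_to_1 ::
    "nat \<Rightarrow> 'a set \<Rightarrow> 'a set set set \<Rightarrow> 'b set set set \<Rightarrow> ('a \<Rightarrow> 'b) \<Rightarrow> bool"
  where "large_scale_n_to_1 n X LX LY f \<longleftrightarrow>
    (\<forall>\<U>Y\<in>LY. \<exists>\<U>X\<in>LX. \<forall>B\<in>\<U>Y. \<exists>C :: nat \<Rightarrow> 'a set.
       (\<forall>i\<in>{1..n}. C i \<in> \<U>X) \<and> f -` B \<inter> X \<subseteq> (\<Union>i\<in>{1..n}. C i))"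

definition bounded_geometry :: "'a set set set \<Rightarrow> bool"
  where "bounded_geometry L \<longleftrightarrow>
    (\<forall>\<U>\<in>L. \<exists>m>0. \<forall>A. (\<exists>U\<in>\<U>. A \<subseteq> U) \<longrightarrow> finite A \<and> card A \<le> m)"

definition close_maps :: "'a set \<Rightarrow> 'b set set set \<Rightarrow> ('a \<Rightarrow> 'b) \<Rightarrow> ('a \<Rightarrow> 'b) \<Rightarrow> bool"
  where "close_maps X LY f g \<longleftrightarrow> (\<exists>\<U>\<in>LY. \<forall>x\<in>X. \<exists>U\<in>\<U>. f x \<in> U \<and> g x \<in> U)"

definition coarse_equivalence ::
    "'a set \<Rightarrow> 'a set set set \<Rightarrow> 'b set \<Rightarrow> 'b set set set \<Rightarrow> ('a \<Rightarrow> 'b) \<Rightarrow> bool"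
  where "coarse_equivalence X LX Y LY f \<longleftrightarrow>
    f \<in> X \<rightarrow> Y \<and> coarse LX LY f \<and>
    (\<exists>g. g \<in> Y \<rightarrow> X \<and> coarse LY LX g \<and>
         close_maps X LX (g \<circ> f) id \<and> close_maps Y LY (f \<circ> g) id)"

lemma large_scale_structure_metric_lss:
  assumes "Metric_space X d"
  shows "large_scale_structure X (metric_lss X d)"
proof -
  interpret Metric_space X d by fact
  have "(\<lambda>x. {x}) ` X \<in> metric_lss X d"
    by (auto simp: metric_lss_def covers_def intro!: exI[of _ 0])
  moreover have "\<V> \<in> metric_lss X d"
    if H: "\<B> \<in> metric_lss X d" "covers \<V> X" "refines \<V> \<B>" for \<B> \<V>
  proof -
    obtain r where r: "\<forall>U\<in>\<B>. \<forall>x\<in>U. \<forall>y\<in>U. d x y \<le> r"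
      using H(1) unfolding metric_lss_def by blast
    have "\<forall>U\<in>\<V>. \<forall>x\<in>U. \<forall>y\<in>U. d x y \<le> r"
      using H(3) r unfolding refines_def by (meson subsetD)
    then show ?thesis using H(2) unfolding metric_lss_def by blast
  qed
  moreover have "st_family \<B> \<C> \<in> metric_lss X d"
    if H: "\<B> \<in> metric_lss X d" "\<C> \<in> metric_lss X d" for \<B> \<C>
  proof -
    obtain r where r: "\<And>B x y. B \<in> \<B> \<Longrightarrow> x \<in> B \<Longrightarrow> y \<in> B \<Longrightarrow> d x y \<le> r"
      using H(1) unfolding metric_lss_def by auto
    obtain s where s: "\<And>C x y. C \<in> \<C> \<Longrightarrow> x \<in> C \<Longrightarrow> y \<in> C \<Longrightarrow> d x y \<le> s"
      using H(2) unfolding metric_lss_def by auto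
    have cov: "\<Union>\<B> = X" "\<Union>\<C> = X"
      using H unfolding metric_lss_def covers_def by auto
    have "\<Union>(st_family \<B> \<C>) = X"
      unfolding st_family_def st_def using cov by blast
    moreover have "d x y \<le> s + r + s" if "B \<in> \<B>" "x \<in> st B \<C>" "y \<in> st B \<C>" for B x y
    proof -
      obtain C D a b where h: "C \<in> \<C>" "D \<in> \<C>" "x \<in> C" "a \<in> C" "a \<in> B" "y \<in> D" "b \<in> D" "b \<in> B"
        using \<open>x \<in> st B \<C>\<close> \<open>y \<in> st B \<C>\<close> unfolding st_def by blast
      then have X: "x \<in> X" "y \<in> X" "a \<in> X" "b \<in> X" using cov by auto
      have "d x a \<le> s" "d a b \<le> r" "d b y \<le> s" using r s h \<open>B \<in> \<B>\<close> by auto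
      moreover have "d x y \<le> d x a + d a y" "d a y \<le> d a b + d b y" using triangle X by auto
      ultimately show ?thesis by linarith
    qed
    ultimately have "\<forall>U\<in>st_family \<B> \<C>. \<forall>x\<in>U. \<forall>y\<in>U. d x y \<le> s + r + s"
      and "\<Union>(st_family \<B> \<C>) = X"
      unfolding st_family_def by blast+
    then show ?thesis unfolding metric_lss_def covers_def by blast
  qed
  moreover have "covers \<B> X" if "\<B> \<in> metric_lss X d" for \<B>
    using that unfolding metric_lss_def by blast
  ultimately show ?thesis
    unfolding large_scale_structure_def by blast
qed

lemma coarse_equivalence_inclusion_iff_net:
  assumes "Metric_space X d" and ZX: "Z \<subseteq> X"
  shows "coarse_equivalence Z (metric_lss Z d) X (metric_lss X d) id \<longleftrightarrow>
    (\<exists>R>0. \<forall>x\<in>X. \<exists>z\<in>Z. d x z \<le> R)"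
proof
  interpret Metric_space X d by fact
  assume "coarse_equivalence Z (metric_lss Z d) X (metric_lss X d) id"
  then obtain g where g: "g \<in> X \<rightarrow> Z" and cl: "close_maps X (metric_lss X d) (id \<circ> g) id"
    unfolding coarse_equivalence_def by blast
  from cl obtain \<U> where \<U>: "\<U> \<in> metric_lss X d"
    and m: "\<And>x. x \<in> X \<Longrightarrow> \<exists>U\<in>\<U>. g x \<in> U \<and> x \<in> U"
    unfolding close_maps_def by auto
  from \<U> obtain r where "\<forall>U\<in>\<U>. \<forall>x\<in>U. \<forall>y\<in>U. d x y \<le> r"
    unfolding metric_lss_def by blast
  with m have r: "\<And>x. x \<in> X \<Longrightarrow> d (g x) x \<le> r" by blast
  show "\<exists>R>0. \<forall>x\<in>X. \<exists>z\<in>Z. d x z \<le> R"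
  proof (intro exI[of _ "max r 1"] conjI ballI)
    fix x assume "x \<in> X"
    then have "g x \<in> Z" "d x (g x) \<le> max r 1" using g r commute[of x "g x"] by force+
    then show "\<exists>z\<in>Z. d x z \<le> max r 1" by blast
  qed simp
next
  interpret Metric_space X d by fact
  assume "\<exists>R>0. \<forall>x\<in>X. \<exists>z\<in>Z. d x z \<le> R"
  then obtain R g where "R > 0" and g: "\<And>x. x \<in> X \<Longrightarrow> g x \<in> Z" "\<And>x. x \<in> X \<Longrightarrow> d x (g x) \<le> R"
    by metis
  have gX: "g x \<in> X" if "x \<in> X" for x using g(1)[OF that] ZX by blast
  define pairs where "pairs W = (\<lambda>x. {x, g x}) ` W" for W
  have bnd: "d u v \<le> R" if "x \<in> X" "u \<in> {x, g x}" "v \<in> {x, g x}" for x u v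
    using that g(2)[OF \<open>x \<in> X\<close>] gX[OF \<open>x \<in> X\<close>] commute[of x "g x"] \<open>R > 0\<close> by auto
  have pairs: "pairs W \<in> metric_lss W d" if "Z \<subseteq> W" "W \<subseteq> X" for W
  proof -
    have "\<Union>(pairs W) = W" using that g(1) unfolding pairs_def by auto
    moreover have "\<forall>U\<in>pairs W. \<forall>u\<in>U. \<forall>v\<in>U. d u v \<le> R"
      unfolding pairs_def using bnd that by blast
    ultimately show ?thesis unfolding metric_lss_def covers_def by blast
  qed
  have inc: "coarse (metric_lss Z d) (metric_lss X d) id"
    unfolding coarse_def
  proof
    fix \<B> assume "\<B> \<in> metric_lss Z d"
    then obtain r where r: "\<And>B x y. B \<in> \<B> \<Longrightarrow> x \<in> B \<Longrightarrow> y \<in> B \<Longrightarrow> d x y \<le> r" and "\<Union>\<B> = Z"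
      unfolding metric_lss_def covers_def by auto
    have "\<forall>U\<in>\<B> \<union> (\<lambda>x. {x}) ` X. \<forall>x\<in>U. \<forall>y\<in>U. d x y \<le> max r 0"
      using r by (force simp: le_max_iff_disj)
    moreover have "\<Union>(\<B> \<union> (\<lambda>x. {x}) ` X) = X" using \<open>\<Union>\<B> = Z\<close> ZX by auto
    ultimately have "\<B> \<union> (\<lambda>x. {x}) ` X \<in> metric_lss X d"
      unfolding metric_lss_def covers_def by blast
    moreover have "refines {id ` B | B. B \<in> \<B>} (\<B> \<union> (\<lambda>x. {x}) ` X)"
      unfolding refines_def by auto
    ultimately show "\<exists>\<B>Y\<in>metric_lss X d. refines {id ` B | B. B \<in> \<B>} \<B>Y" by blast
  qed
  have ret: "coarse (metric_lss X d) (metric_lss Z d) g"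
    unfolding coarse_def
  proof
    fix \<B> assume "\<B> \<in> metric_lss X d"
    then obtain r where r: "\<And>B x y. B \<in> \<B> \<Longrightarrow> x \<in> B \<Longrightarrow> y \<in> B \<Longrightarrow> d x y \<le> r" and cov: "\<Union>\<B> = X"
      unfolding metric_lss_def covers_def by auto
    let ?C = "{g ` B | B. B \<in> \<B>} \<union> (\<lambda>x. {x}) ` Z"
    have "d u v \<le> max (R + r + R) 0" if H: "B \<in> \<B>" "u \<in> g ` B" "v \<in> g ` B" for B u v
    proof -
      obtain x y where h: "x \<in> B" "y \<in> B" "u = g x" "v = g y" using H by blast
      then have X: "x \<in> X" "y \<in> X" "g x \<in> X" "g y \<in> X" using cov \<open>B \<in> \<B>\<close> gX by auto
      have "d (g x) (g y) \<le> d (g x) x + d x (g y)" "d x (g y) \<le> d x y + d y (g y)"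
        using triangle X by auto
      moreover have "d (g x) x \<le> R" "d y (g y) \<le> R" "d x y \<le> r"
        using g(2) X commute r h \<open>B \<in> \<B>\<close> by auto
      ultimately show ?thesis unfolding h by linarith
    qed
    moreover have "d u v \<le> max (R + r + R) 0" if "z \<in> Z" "u \<in> {z}" "v \<in> {z}" for z u v
      using that ZX by auto
    ultimately have "\<forall>U\<in>?C. \<forall>u\<in>U. \<forall>v\<in>U. d u v \<le> max (R + r + R) 0" by blast
    moreover have "\<Union>?C = Z" using g(1) cov by auto
    ultimately have "?C \<in> metric_lss Z d" unfolding metric_lss_def covers_def by blast
    moreover have "refines {g ` B | B. B \<in> \<B>} ?C" unfolding refines_def by auto
    ultimately show "\<exists>\<B>Y\<in>metric_lss Z d. refines {g ` B | B. B \<in> \<B>} \<B>Y" by blast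
  qed
  have "close_maps Z (metric_lss Z d) (g \<circ> id) id" "close_maps X (metric_lss X d) (id \<circ> g) id"
    unfolding close_maps_def
    by (rule bexI[OF _ pairs]; auto simp: pairs_def ZX)+
  then show "coarse_equivalence Z (metric_lss Z d) X (metric_lss X d) id"
    unfolding coarse_equivalence_def using inc ret g(1) ZX by auto
qed

text \<open>
  Bounded geometry counts points, so a coarse large scale \<open>n\<close>-to-1 map transfers it from its domain
  to its codomain only if it is surjective: points outside the image are not controlled by the domain.
\<close>

lemma bounded_geometry_transfer_needs_surjectivity:
  "\<exists>(X :: nat set) LX (Y :: nat set) LY f.
     large_scale_structure X LX \<and> large_scale_structure Y LY \<and> f \<in> X \<rightarrow> Y \<and>
     coarse LX LY f \<and> (\<forall>n\<ge>1. large_scale_n_to_1 n X LX LY f) \<and>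
     bounded_geometry LX \<and> \<not> bounded_geometry LY"
proof -
  define LX where "LX = {\<U>. covers \<U> {0::nat}}"
  define LY where "LY = {\<U>. covers \<U> (UNIV :: nat set)}"
  have X: "{{0}} \<in> LX" and Y: "{UNIV} \<in> LY" by (simp_all add: LX_def LY_def covers_def)
  have st: "covers (st_family \<B> \<C>) W" if "covers \<B> W" "covers \<C> W"
    for \<B> \<C> :: "nat set set" and W
    using that unfolding covers_def st_family_def st_def by blast
  have "large_scale_structure {0} LX"
    unfolding large_scale_structure_def using X st unfolding LX_def by blast
  moreover have "large_scale_structure UNIV LY"
    unfolding large_scale_structure_def using Y st unfolding LY_def by blast
  moreover have "coarse LX LY id"
    unfolding coarse_def refines_def using Y by blast
  moreover have "large_scale_n_to_1 n {0} LX LY id" if "n \<ge> 1" for n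
    unfolding large_scale_n_to_1_def
    by (intro ballI bexI[OF _ X] exI[of _ "\<lambda>_. {0}"]) (use that in auto)
  moreover have "bounded_geometry LX"
    unfolding bounded_geometry_def
  proof (intro ballI exI[of _ "1::nat"] conjI allI impI)
    fix \<U> A assume "\<U> \<in> LX" "\<exists>U\<in>\<U>. A \<subseteq> U"
    then have "A \<subseteq> {0}" unfolding LX_def covers_def by blast
    then show "finite A" "card A \<le> 1" using finite_subset card_mono[of "{0::nat}" A] by auto
  qed auto
  moreover have "\<not> bounded_geometry LY"
    unfolding bounded_geometry_def using Y infinite_UNIV_nat by blast
  ultimately show ?thesis
    by (intro exI[of _ "{0}"] exI[of _ LX] exI[of _ UNIV] exI[of _ LY] exI[of _ id]) auto
qed

end

theory Submission
  imports Defs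
begin

text \<open>
  Both halves are counting arguments along the fibres of \<open>f\<close>.

  If \<open>f\<close> is onto, a member \<open>B\<close> of a uniformly bounded cover of \<open>Y\<close> is the image of its preimage,
  which lies in \<open>n\<close> members of a single uniformly bounded cover of \<open>X\<close>. When those have at most \<open>m\<close>
  points each, \<open>B\<close> has at most \<open>n * m\<close>.

  For the converse, apply the \<open>n\<close>-to-1 condition to the cover of \<open>Y\<close> by points: every fibre of \<open>f\<close>
  is covered by \<open>n\<close> sets whose diameters have one common bound \<open>r\<close>. Let \<open>Z\<close> consist of one point of
  the fibre from each of these sets that meets it. Then \<open>Z\<close> is within distance \<open>r\<close> of every point
  of \<open>X\<close>, which makes the inclusion a coarse equivalence, and \<open>f\<close> has at most \<open>n\<close> points of \<open>Z\<close> in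
  each fibre (\<open>exists_transversal\<close>). A bounded subset of \<open>Z\<close> has an image in \<open>Y\<close> of
  controlled cardinality, because \<open>f\<close> is coarse and \<open>Y\<close> has bounded geometry; multiplying by \<open>n\<close>
  bounds the number of its points (\<open>bounded_geometry_of_finite_fibres\<close>).
\<close>

lemma card_le_of_fibres:
  assumes "finite (f ` A)" "card (f ` A) \<le> m"
    and fib: "\<And>y. y \<in> f ` A \<Longrightarrow> finite (A \<inter> f -` {y}) \<and> card (A \<inter> f -` {y}) \<le> n"
  shows "finite A \<and> card A \<le> n * m"
proof -
  have A: "A = (\<Union>y\<in>f ` A. A \<inter> f -` {y})" by blast
  have "finite (\<Union>y\<in>f ` A. A \<inter> f -` {y})" using assms(1) fib by blast
  moreover have "card (\<Union>y\<in>f ` A. A \<inter> f -` {y}) \<le> (\<Sum>y\<in>f ` A. card (A \<inter> f -` {y}))"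
    by (rule card_UN_le[OF assms(1)])
  moreover have "\<dots> \<le> card (f ` A) * n"
    using sum_bounded_above[of "f ` A" "\<lambda>y. card (A \<inter> f -` {y})" n] fib by simp
  moreover have "\<dots> \<le> n * m" using assms(2) by simp
  ultimately show ?thesis unfolding A[symmetric] by linarith
qed

lemma exists_transversal:
  assumes "finite I" "F \<subseteq> (\<Union>i\<in>I. C i)"
  obtains P where "P \<subseteq> F" "finite P" "card P \<le> card I"
    "\<And>x. x \<in> F \<Longrightarrow> \<exists>p\<in>P. \<exists>i\<in>I. x \<in> C i \<and> p \<in> C i"
proof -
  define J where "J = {i \<in> I. C i \<inter> F \<noteq> {}}"
  have J: "finite J" "card J \<le> card I"
    unfolding J_def using assms(1) by (auto intro: card_mono)
  have "\<forall>i\<in>J. \<exists>p. p \<in> C i \<inter> F" unfolding J_def by blast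
  then obtain c where c: "\<And>i. i \<in> J \<Longrightarrow> c i \<in> C i \<inter> F" by metis
  show thesis
  proof
    show "c ` J \<subseteq> F" "finite (c ` J)" using c J by auto
    show "card (c ` J) \<le> card I" using card_image_le[OF J(1), of c] J(2) by simp
    show "\<exists>p\<in>c ` J. \<exists>i\<in>I. x \<in> C i \<and> p \<in> C i" if "x \<in> F" for x
    proof -
      obtain i where i: "i \<in> I" "x \<in> C i" using assms(2) \<open>x \<in> F\<close> by blast
      then have "i \<in> J" using \<open>x \<in> F\<close> unfolding J_def by blast
      with i c show ?thesis by blast
    qed
  qed
qed

lemma singletons_in_large_scale_structure:
  assumes "large_scale_structure Y L"
  shows "(\<lambda>y. {y}) ` Y \<in> L"
proof -
  obtain \<B> where \<B>: "\<B> \<in> L" "covers \<B> Y"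
    using assms unfolding large_scale_structure_def by blast
  have "covers ((\<lambda>y. {y}) ` Y) Y" by (simp add: covers_def)
  moreover have "refines ((\<lambda>y. {y}) ` Y) \<B>"
    using \<B>(2) unfolding covers_def refines_def by auto
  ultimately show ?thesis
    using assms \<B>(1) unfolding large_scale_structure_def by blast
qed

lemma metric_lss_extend_subspace:
  assumes "Metric_space X d" "Z \<subseteq> X" "\<U> \<in> metric_lss Z d"
  shows "\<U> \<union> (\<lambda>x. {x}) ` X \<in> metric_lss X d"
proof -
  interpret Metric_space X d by fact
  obtain r where r: "\<forall>U\<in>\<U>. \<forall>x\<in>U. \<forall>y\<in>U. d x y \<le> r" and "\<Union>\<U> = Z"
    using assms(3) unfolding metric_lss_def covers_def by blast
  have "\<forall>U\<in>\<U> \<union> (\<lambda>x. {x}) ` X. \<forall>x\<in>U. \<forall>y\<in>U. d x y \<le> max r 0"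
    using r by (force simp: le_max_iff_disj)
  moreover have "\<Union>(\<U> \<union> (\<lambda>x. {x}) ` X) = X" using \<open>\<Union>\<U> = Z\<close> assms(2) by auto
  ultimately show ?thesis unfolding metric_lss_def covers_def by blast
qed

lemma bounded_geometry_surjective_image:
  assumes "large_scale_n_to_1 n X LX LY f" "n \<ge> 1"
    and "large_scale_structure Y LY" "f ` X = Y" "bounded_geometry LX"
  shows "bounded_geometry LY"
  unfolding bounded_geometry_def
proof
  fix \<V> assume \<V>: "\<V> \<in> LY"
  then have "\<Union>\<V> = Y"
    using assms(3) by (simp add: large_scale_structure_def covers_def)
  obtain \<U> where \<U>: "\<U> \<in> LX"
    and cov: "\<And>B. B \<in> \<V> \<Longrightarrow>
      \<exists>C :: nat \<Rightarrow> 'a set. (\<forall>i\<in>{1..n}. C i \<in> \<U>) \<and> f -` B \<inter> X \<subseteq> (\<Union>i\<in>{1..n}. C i)"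
    using assms(1) \<V> unfolding large_scale_n_to_1_def by meson
  obtain m where "m > 0" and m: "\<And>U. U \<in> \<U> \<Longrightarrow> finite U \<and> card U \<le> m"
    using assms(5) \<U> unfolding bounded_geometry_def by (metis order_refl)
  have "finite A \<and> card A \<le> n * m" if "B \<in> \<V>" "A \<subseteq> B" for A B
  proof -
    obtain C where C: "\<forall>i\<in>{1..n}. C i \<in> \<U>" "f -` B \<inter> X \<subseteq> (\<Union>i\<in>{1..n}. C i)"
      using cov[OF \<open>B \<in> \<V>\<close>] by blast
    let ?D = "\<Union>i\<in>{1..n}. C i"
    have "A \<subseteq> f ` ?D"
    proof
      fix y assume "y \<in> A"
      then have "y \<in> B" "y \<in> Y" using that \<open>\<Union>\<V> = Y\<close> by auto
      then show "y \<in> f ` ?D" using assms(4) C(2) by blast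
    qed
    moreover have D: "finite ?D" using C(1) m by blast
    moreover have "card ?D \<le> (\<Sum>i\<in>{1..n}. card (C i))" by (simp add: card_UN_le)
    moreover have "\<dots> \<le> n * m"
      using sum_bounded_above[of "{1..n}" "\<lambda>i. card (C i)" m] C(1) m by simp
    moreover have "card (f ` ?D) \<le> card ?D" by (rule card_image_le[OF D])
    moreover have "finite A" "card A \<le> card (f ` ?D)"
      using \<open>A \<subseteq> f ` ?D\<close> D by (meson finite_imageI finite_subset card_mono)+
    ultimately show ?thesis by linarith
  qed
  moreover have "n * m > 0" using \<open>m > 0\<close> assms(2) by simp
  ultimately show "\<exists>m>0. \<forall>A. (\<exists>U\<in>\<V>. A \<subseteq> U) \<longrightarrow> finite A \<and> card A \<le> m" by blast
qed

lemma bounded_geometry_of_finite_fibres: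
  assumes "Metric_space X d" "Z \<subseteq> X"
    and "coarse (metric_lss X d) LY f" "bounded_geometry LY" "n \<ge> 1"
    and fib: "\<And>y. y \<in> f ` Z \<Longrightarrow> finite (Z \<inter> f -` {y}) \<and> card (Z \<inter> f -` {y}) \<le> n"
  shows "bounded_geometry (metric_lss Z d)"
  unfolding bounded_geometry_def
proof
  fix \<U> assume \<U>: "\<U> \<in> metric_lss Z d"
  \<comment> \<open>Coarseness speaks of covers of all of \<open>X\<close>, so \<open>\<U>\<close> is first completed by points.\<close>
  obtain \<V> where "\<V> \<in> LY"
    and ref: "refines {f ` B | B. B \<in> \<U> \<union> (\<lambda>x. {x}) ` X} \<V>"
    using metric_lss_extend_subspace[OF assms(1,2) \<U>] assms(3) unfolding coarse_def by blast
  then obtain m where "m > 0"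
    and m: "\<And>A V. V \<in> \<V> \<Longrightarrow> A \<subseteq> V \<Longrightarrow> finite A \<and> card A \<le> m"
    using assms(4) unfolding bounded_geometry_def by meson
  have "finite A \<and> card A \<le> n * m" if "U \<in> \<U>" "A \<subseteq> U" for A U
  proof (rule card_le_of_fibres)
    obtain V where "V \<in> \<V>" "f ` U \<subseteq> V" using ref \<open>U \<in> \<U>\<close> unfolding refines_def by blast
    moreover have "f ` A \<subseteq> f ` U" using \<open>A \<subseteq> U\<close> by (rule image_mono)
    ultimately have "finite (f ` A) \<and> card (f ` A) \<le> m" using m[of V "f ` A"] by simp
    then show "finite (f ` A)" "card (f ` A) \<le> m" by auto
    have "A \<subseteq> Z" using that \<U> unfolding metric_lss_def covers_def by blast
    show "finite (A \<inter> f -` {y}) \<and> card (A \<inter> f -` {y}) \<le> n" if "y \<in> f ` A" for y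
    proof -
      have "A \<inter> f -` {y} \<subseteq> Z \<inter> f -` {y}" using \<open>A \<subseteq> Z\<close> by blast
      moreover have "finite (Z \<inter> f -` {y}) \<and> card (Z \<inter> f -` {y}) \<le> n"
        using fib[of y] \<open>A \<subseteq> Z\<close> that by blast
      ultimately show ?thesis by (meson card_mono finite_subset order_trans)
    qed
  qed
  moreover have "n * m > 0" using \<open>m > 0\<close> assms(5) by simp
  ultimately show "\<exists>m>0. \<forall>A. (\<exists>U\<in>\<U>. A \<subseteq> U) \<longrightarrow> finite A \<and> card A \<le> m" by blast
qed

text \<open>
  The points selected in the separate fibres form a net with one and the same constant, since all
  the sets that cover fibres are drawn from a single uniformly bounded cover of \<open>X\<close>.
\<close>

lemma net_with_finite_fibres:
  assumes "large_scale_n_to_1 n X (metric_lss X d) LY f"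
    and "large_scale_structure Y LY" "f \<in> X \<rightarrow> Y"
  obtains Z R where "Z \<subseteq> X" "R > 0" "\<And>x. x \<in> X \<Longrightarrow> \<exists>z\<in>Z. d x z \<le> R"
    "\<And>y. y \<in> Y \<Longrightarrow> finite (Z \<inter> f -` {y}) \<and> card (Z \<inter> f -` {y}) \<le> n"
proof -
  obtain \<U> where \<U>: "\<U> \<in> metric_lss X d"
    and cov: "\<And>B. B \<in> (\<lambda>y. {y}) ` Y \<Longrightarrow>
      \<exists>C :: nat \<Rightarrow> 'a set. (\<forall>i\<in>{1..n}. C i \<in> \<U>) \<and> f -` B \<inter> X \<subseteq> (\<Union>i\<in>{1..n}. C i)"
    using assms(1) singletons_in_large_scale_structure[OF assms(2)]
    unfolding large_scale_n_to_1_def by meson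
  obtain r where r: "\<And>U x y. U \<in> \<U> \<Longrightarrow> x \<in> U \<Longrightarrow> y \<in> U \<Longrightarrow> d x y \<le> r"
    using \<U> unfolding metric_lss_def by auto
  have "\<exists>P. P \<subseteq> f -` {y} \<inter> X \<and> finite P \<and> card P \<le> n \<and>
      (\<forall>x\<in>f -` {y} \<inter> X. \<exists>p\<in>P. d x p \<le> r)" if "y \<in> Y" for y
  proof -
    obtain C where C: "\<forall>i\<in>{1..n}. C i \<in> \<U>" "f -` {y} \<inter> X \<subseteq> (\<Union>i\<in>{1..n}. C i)"
      using cov[of "{y}"] \<open>y \<in> Y\<close> by blast
    obtain P where "P \<subseteq> f -` {y} \<inter> X" "finite P" "card P \<le> card {1..n}"
      "\<And>x. x \<in> f -` {y} \<inter> X \<Longrightarrow> \<exists>p\<in>P. \<exists>i\<in>{1..n}. x \<in> C i \<and> p \<in> C i"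
      using exists_transversal[OF finite_atLeastAtMost C(2)] by blast
    moreover from this have "\<forall>x\<in>f -` {y} \<inter> X. \<exists>p\<in>P. d x p \<le> r"
      using C(1) r by blast
    ultimately show ?thesis by (intro exI[of _ P]) simp
  qed
  then obtain P where P: "\<And>y. y \<in> Y \<Longrightarrow> P y \<subseteq> f -` {y} \<inter> X \<and> finite (P y) \<and> card (P y) \<le> n \<and>
      (\<forall>x\<in>f -` {y} \<inter> X. \<exists>p\<in>P y. d x p \<le> r)"
    by metis
  show thesis
  proof
    show "(\<Union>y\<in>Y. P y) \<subseteq> X" using P by blast
    show "max r 1 > 0" by simp
    show "\<exists>z\<in>\<Union>y\<in>Y. P y. d x z \<le> max r 1" if "x \<in> X" for x
    proof -
      have "f x \<in> Y" using assms(3) that by blast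
      moreover have "x \<in> f -` {f x} \<inter> X" using that by simp
      ultimately obtain p where "p \<in> P (f x)" "d x p \<le> r" using P by meson
      then show ?thesis using \<open>f x \<in> Y\<close> by (meson UN_I max.coboundedI1)
    qed
    show "finite ((\<Union>y\<in>Y. P y) \<inter> f -` {y}) \<and> card ((\<Union>y\<in>Y. P y) \<inter> f -` {y}) \<le> n"
      if "y \<in> Y" for y
    proof -
      have "(\<Union>y\<in>Y. P y) \<inter> f -` {y} = P y" using P that by blast
      then show ?thesis using P that by simp
    qed
  qed
qed

theorem theorem1p6:
  fixes X :: "'a set" and LX :: "'a set set set"
    and Y :: "'b set" and LY :: "'b set set set"
    and n :: nat and f :: "'a \<Rightarrow> 'b"
  assumes "large_scale_structure X LX" and "large_scale_structure Y LY"
    and "n \<ge> 1"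
    and "f \<in> X \<rightarrow> Y"
    and "coarse LX LY f"
    and "large_scale_n_to_1 n X LX LY f"
  shows "(f ` X = Y \<and> bounded_geometry LX \<longrightarrow> bounded_geometry LY) \<and>
    (\<forall>dX dY. Metric_space X dX \<and> LX = metric_lss X dX \<and>
             Metric_space Y dY \<and> LY = metric_lss Y dY \<and> bounded_geometry LY \<longrightarrow>
       (\<exists>Z\<subseteq>X. bounded_geometry (metric_lss Z dX) \<and>
              coarse_equivalence Z (metric_lss Z dX) X LX id))"
proof (intro conjI allI impI)
  assume "f ` X = Y \<and> bounded_geometry LX"
  then show "bounded_geometry LY"
    using bounded_geometry_surjective_image assms by blast
next
  fix dX dY
  assume H: "Metric_space X dX \<and> LX = metric_lss X dX \<and>
             Metric_space Y dY \<and> LY = metric_lss Y dY \<and> bounded_geometry LY"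
  then have M: "Metric_space X dX" and LX: "LX = metric_lss X dX" and BY: "bounded_geometry LY"
    by blast+
  obtain Z R where Z: "Z \<subseteq> X" "R > 0" "\<And>x. x \<in> X \<Longrightarrow> \<exists>z\<in>Z. dX x z \<le> R"
    and fib: "\<And>y. y \<in> Y \<Longrightarrow> finite (Z \<inter> f -` {y}) \<and> card (Z \<inter> f -` {y}) \<le> n"
    using net_with_finite_fibres[OF assms(6)[unfolded LX] assms(2,4)] by blast
  have "f ` Z \<subseteq> Y" using Z(1) assms(4) by blast
  then have "bounded_geometry (metric_lss Z dX)"
    using bounded_geometry_of_finite_fibres[OF M Z(1) assms(5)[unfolded LX] BY assms(3)] fib
    by blast
  moreover have "coarse_equivalence Z (metric_lss Z dX) X LX id"
    unfolding LX coarse_equivalence_inclusion_iff_net[OF M Z(1)] using Z(2,3) by blast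
  ultimately show "\<exists>Z\<subseteq>X. bounded_geometry (metric_lss Z dX) \<and>
      coarse_equivalence Z (metric_lss Z dX) X LX id"
    using Z(1) by blast
qed

end
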